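(* Let $\mathcal G_N$ be a subset of $\mathbb P^N$ and let $\Sigma$ be an analytically meagre subset of $\mathbb P^N$. Let $\mathcal G_{N-1}$ be a subset of $\mathbb P^{N-1}$ such that $\mathcal G_{N-1}\setminus\mathcal S_{N-1}$ is dense in $\mathbb P^{N-1}$ in the classical topology for every analytically meagre subset $\mathcal S_{N-1}$ of $\mathbb P^{N-1}$. Let $P\in\mathbb P^N$ and let $p:\mathbb P^N\setminus\{P\}\to\mathbb P^{N-1}$ be the linear projection from $P$. Assume that for every $x\in\mathcal G_{N-1}$ with $p^{-1}(x)\setminus\Sigma\neq\emptyset$, almost all points of $p^{-1}(x)$ are contained in $\mathcal G_N$. Then $\mathcal G_N\setminus\mathcal S_N$ is dense in $\mathbb P^N$ in the classical topology for every analytically meagre subset $\mathcal S_N$ of $\mathbb P^N$.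
   Context: A subset of a complex analytic space $X$ is analytically meagre if it is contained in a countable union of locally closed analytic subsets of $X$ of codimension $\ge 1$. Here $p^{-1}(x)\simeq\mathbb C$, and "almost all points of $p^{-1}(x)$" means all points outside a subset of $p^{-1}(x)$ of Lebesgue measure zero. *)

theory Defs
  imports "HOL-Analysis.Analysis"
begin

text \<open>Complex projective space P(V) for V = complex^'n (so P^N with N+1 = CARD('n)):
  a point is a complex line through the origin, i.e. a set of vectors.\<close>

definition cline :: "complex^'n \<Rightarrow> (complex^'n) set" where
  "cline v = {c *s v | c. True}"

definition PS :: "(complex^'n) set set" where
  "PS = {cline v | v. v \<noteq> 0}"

text \<open>Cone over a set of projective points (preimage under C^{N+1}-{0} -> P^N).\<close>
definition cone :: "(complex^'n) set set \<Rightarrow> (complex^'n) set" where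
  "cone A = {v. v \<noteq> 0 \<and> cline v \<in> A}"

text \<open>Classical (quotient) topology: U \<subseteq> P^N is open iff its cone is open.\<close>
definition proj_open :: "(complex^'n) set set \<Rightarrow> bool" where
  "proj_open U \<longleftrightarrow> U \<subseteq> PS \<and> open (cone U)"

definition proj_dense :: "(complex^'n) set set \<Rightarrow> bool" where
  "proj_dense X \<longleftrightarrow> (\<forall>U. proj_open U \<and> U \<noteq> {} \<longrightarrow> U \<inter> X \<noteq> {})"

text \<open>Holomorphic functions of several complex variables: complex Frechet differentiable.\<close>
definition holo_on :: "(complex^'n \<Rightarrow> complex) \<Rightarrow> (complex^'n) set \<Rightarrow> bool" where
  "holo_on f V \<longleftrightarrow> (\<forall>z\<in>V. \<exists>D. (f has_derivative D) (at z) \<and>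
        (\<forall>c x. D (c *s x) = c * D x))"

text \<open>Locally closed analytic subset of C^{N+1}-{0}: locally the common zero set of
  finitely many holomorphic functions.\<close>
definition lc_analytic :: "(complex^'n) set \<Rightarrow> bool" where
  "lc_analytic C \<longleftrightarrow> 0 \<notin> C \<and> (\<forall>a\<in>C. \<exists>V F. open V \<and> a \<in> V \<and> 0 \<notin> V \<and> finite F \<and>
       (\<forall>f\<in>F. holo_on f V) \<and> C \<inter> V = {z\<in>V. \<forall>f\<in>F. f z = 0})"

text \<open>Locally closed analytic subset of P^N of codimension \<ge> 1 (via its cone;
  codimension \<ge> 1 of an analytic subset of a connected manifold = empty interior).\<close>
definition proj_lc_analytic_codim1 :: "(complex^'n) set set \<Rightarrow> bool" where
  "proj_lc_analytic_codim1 A \<longleftrightarrow> A \<subseteq> PS \<and> lc_analytic (cone A) \<and> interior (cone A) = {}"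

definition analytically_meagre :: "(complex^'n) set set \<Rightarrow> bool" where
  "analytically_meagre S \<longleftrightarrow>
     (\<exists>A :: nat \<Rightarrow> (complex^'n) set set. (\<forall>i. proj_lc_analytic_codim1 (A i)) \<and> S \<subseteq> (\<Union>i. A i))"

text \<open>Linear projection from P = cline v: induced by a complex-linear surjection L
  with kernel the line v; p(y) = L ` y.\<close>
definition lin_proj_from :: "(complex^'n) \<Rightarrow> (complex^'n \<Rightarrow> complex^'m) \<Rightarrow> bool" where
  "lin_proj_from v L \<longleftrightarrow> v \<noteq> 0 \<and> Vector_Spaces.linear (*s) (*s) L \<and> surj L \<and>
      {u. L u = 0} = cline v"

definition proj_fiber :: "(complex^'n) \<Rightarrow> (complex^'n \<Rightarrow> complex^'m) \<Rightarrow> (complex^'m) set \<Rightarrow> (complex^'n) set set" where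
  "proj_fiber v L x = {y \<in> PS. y \<noteq> cline v \<and> L ` y = x}"

end

theory Submission
  imports Defs "HOL-Complex_Analysis.Conformal_Mappings"
begin

text \<open>If a hypersurface \<open>A\<close> (a locally closed analytic subset of codimension \<open>\<ge> 1\<close>) meets the
  line through \<open>P\<close> over \<open>x\<close> in a set of positive measure, the identity theorem makes it contain
  a disc of that line. Such a disc is hit by one of countably many linear sections
  \<open>w \<mapsto> lift w + c w\<^sub>i v\<close> of the projection (\<open>c\<close> from a countable dense set), and pulling
  \<open>A\<close> back along that section gives an analytic cone containing \<open>x\<close>. If this cone had interior,
  the identity theorem would spread it over an open subset of the cone over \<open>A\<close>, which has
  none. So the \<open>x\<close> whose line meets a meagre set in positive measure form a meagre set \<open>S'\<close>.
  Density of \<open>G_{N-1}\<close> gives a point \<open>x\<close> of \<open>G_{N-1}\<close> outside \<open>S'\<close> in the projection of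
  any open \<open>U\<close>. The line over \<open>x\<close> is then not covered by \<open>\<Sigma>\<close>, so almost all of it lies in
  \<open>G_N\<close> and outside \<open>S\<close>; as it meets \<open>U\<close> in a nonempty open set, one of these points lies
  in \<open>U\<close>.\<close>

section \<open>Complex lines and scaling-invariant sets\<close>

abbreviation clinear :: "(complex^'a \<Rightarrow> complex^'b) \<Rightarrow> bool" where
  "clinear f \<equiv> Vector_Spaces.linear (*s) (*s) f"

lemma scaleR_eq_smult_of_real: "r *\<^sub>R (x::complex^'a) = complex_of_real r *s x"
  by (simp add: vec_eq_iff scaleR_conv_of_real[where 'a=complex])

lemma clinear_imp_linear: "clinear f \<Longrightarrow> linear f"
  by (simp add: linear_iff vec.linear_add vec.linear_scale scaleR_eq_smult_of_real)

lemma clinearI: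
  assumes "\<And>x y. f (x + y) = f x + f y" "\<And>c x. f (c *s x) = c *s f x"
  shows "clinear f"
  unfolding Vector_Spaces.linear_def module_hom_def module_hom_axioms_def
  using assms by (auto simp: vec.vector_space_axioms module_iff_vector_space)

lemma open_clinear_vimage: "clinear f \<Longrightarrow> open B \<Longrightarrow> open (f -` B)"
  by (metis clinear_imp_linear linear_conv_bounded_linear linear_continuous_on open_vimage)

lemma linear_smult_left: "linear (\<lambda>t::complex. t *s (q::complex^'a))"
  by (simp add: linear_iff vec_eq_iff algebra_simps scaleR_conv_of_real[where 'a=complex])

lemma open_line_vimage: "open V \<Longrightarrow> open {t::complex. p + t *s (q::complex^'a) \<in> V}"
proof -
  assume "open V"
  have "continuous_on UNIV (\<lambda>t::complex. p + t *s q)"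
    using linear_smult_left[of q] by (intro continuous_intros)
      (simp add: linear_conv_bounded_linear linear_continuous_on)
  then show ?thesis
    using open_vimage[OF \<open>open V\<close>] by (simp add: vimage_def)
qed

lemma convex_line_vimage: "convex K \<Longrightarrow> convex {t::complex. p + t *s (q::complex^'a) \<in> K}"
proof -
  assume "convex K"
  have "{t. p + t *s q \<in> K} = (\<lambda>t. t *s q) -` ((+) (- p) ` K)"
    by (force simp: algebra_simps)
  then show ?thesis
    by (metis convex_linear_vimage linear_smult_left convex_translation \<open>convex K\<close>)
qed

lemma self_in_cline: "z \<in> cline z"
  unfolding cline_def by (auto intro: exI[of _ 1])

lemma mem_cline_iff: "y \<in> cline z \<longleftrightarrow> (\<exists>c. y = c *s z)"
  by (auto simp: cline_def)

lemma cline_smult: "c \<noteq> 0 \<Longrightarrow> cline (c *s z) = cline z"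
  unfolding set_eq_iff mem_cline_iff
  by (metis vector_smult_assoc nonzero_divide_eq_eq)

lemma cline_eq_imp_smult: "w \<noteq> 0 \<Longrightarrow> cline w = cline z \<Longrightarrow> \<exists>c. c \<noteq> 0 \<and> w = c *s z"
  by (metis self_in_cline mem_cline_iff vector_smult_lzero)

lemma clinear_image_cline: "clinear L \<Longrightarrow> L ` cline z = cline (L z)"
  unfolding cline_def using vec.linear_scale by fastforce

lemma cline_in_PS: "z \<noteq> 0 \<Longrightarrow> cline z \<in> PS"
  unfolding PS_def by auto

lemma cone_nonempty: "A \<subseteq> PS \<Longrightarrow> A \<noteq> {} \<Longrightarrow> cone A \<noteq> {}"
  unfolding PS_def cone_def by blast

definition scaling_invariant :: "(complex^'a) set \<Rightarrow> bool" where
  "scaling_invariant E \<longleftrightarrow> (\<forall>z c. z \<in> E \<longrightarrow> c \<noteq> 0 \<longrightarrow> c *s z \<in> E)"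

definition cstar_saturation :: "(complex^'a) set \<Rightarrow> (complex^'a) set" where
  "cstar_saturation B = {z. \<exists>c. c \<noteq> 0 \<and> c *s z \<in> B}"

lemma scaling_invariant_cone: "scaling_invariant (cone A)"
  unfolding scaling_invariant_def cone_def by (auto simp: cline_smult vec_eq_iff)

lemma scaling_invariant_cstar_saturation: "scaling_invariant (cstar_saturation B)"
  unfolding scaling_invariant_def cstar_saturation_def
proof (intro allI impI)
  fix z and c :: complex
  assume "z \<in> {z. \<exists>d. d \<noteq> 0 \<and> d *s z \<in> B}" "c \<noteq> 0"
  then obtain d where "d \<noteq> 0" "d *s z \<in> B" by blast
  then have "(d / c) *s (c *s z) \<in> B"
    using \<open>c \<noteq> 0\<close> by simp
  then show "c *s z \<in> {z. \<exists>d. d \<noteq> 0 \<and> d *s z \<in> B}"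
    using \<open>c \<noteq> 0\<close> \<open>d \<noteq> 0\<close> by (intro CollectI exI[of _ "d / c"]) simp
qed

lemma scaling_invariant_Int:
  "scaling_invariant E \<Longrightarrow> scaling_invariant E' \<Longrightarrow> scaling_invariant (E \<inter> E')"
  unfolding scaling_invariant_def by blast

lemma scaling_invariant_Diff_0: "scaling_invariant E \<Longrightarrow> scaling_invariant (E - {0})"
  unfolding scaling_invariant_def by (auto simp: vec_eq_iff)

lemma scaling_invariant_clinear_vimage:
  "clinear M \<Longrightarrow> scaling_invariant E \<Longrightarrow> scaling_invariant (M -` E)"
  unfolding scaling_invariant_def by (simp add: vec.linear_scale)

lemma scaling_invariant_clinear_image:
  assumes "clinear M" "scaling_invariant E" shows "scaling_invariant (M ` E)"
  unfolding scaling_invariant_def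
proof (intro allI impI)
  fix y and c :: complex assume "y \<in> M ` E" "c \<noteq> 0"
  then obtain z where "z \<in> E" "y = M z" by blast
  then have "c *s y = M (c *s z)" "c *s z \<in> E"
    using assms \<open>c \<noteq> 0\<close> by (simp_all add: vec.linear_scale scaling_invariant_def)
  then show "c *s y \<in> M ` E" by blast
qed

lemma scaling_invariant_interior:
  assumes "scaling_invariant E" shows "scaling_invariant (interior E)"
  unfolding scaling_invariant_def
proof (intro allI impI)
  fix z and c :: complex assume "z \<in> interior E" "c \<noteq> 0"
  have "linear ((*s) c :: complex^'a \<Rightarrow> _)" "inj ((*s) c :: complex^'a \<Rightarrow> _)"
    using \<open>c \<noteq> 0\<close> by (auto simp: clinear_imp_linear inj_on_def vec_eq_iff)
  then have "interior ((*s) c ` E) = (*s) c ` interior E"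
    by (rule interior_injective_linear_image)
  then have "c *s z \<in> interior ((*s) c ` E)"
    using \<open>z \<in> interior E\<close> by blast
  also have "\<dots> \<subseteq> interior E"
    using assms \<open>c \<noteq> 0\<close> by (intro interior_mono) (auto simp: scaling_invariant_def)
  finally show "c *s z \<in> interior E" .
qed

lemma subset_cstar_saturation: "B \<subseteq> cstar_saturation B"
  unfolding cstar_saturation_def by (auto intro: exI[of _ 1])

lemma open_cstar_saturation: "open B \<Longrightarrow> open (cstar_saturation B)"
proof -
  assume "open B"
  have "cstar_saturation B = (\<Union>c\<in>-{0}. (*s) c -` B)"
    unfolding cstar_saturation_def by blast
  then show ?thesis
    using open_clinear_vimage[OF vec.linear_scale_self \<open>open B\<close>] by auto
qed

lemma cone_cline_image:
  assumes "scaling_invariant E" "0 \<notin> E"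
  shows "cone (cline ` E) = E"
proof
  show "cone (cline ` E) \<subseteq> E"
  proof
    fix z assume "z \<in> cone (cline ` E)"
    then obtain e where "z \<noteq> 0" "e \<in> E" "cline z = cline e"
      unfolding cone_def by auto
    then show "z \<in> E"
      using assms(1) cline_eq_imp_smult unfolding scaling_invariant_def by metis
  qed
  show "E \<subseteq> cone (cline ` E)"
    using assms(2) unfolding cone_def by auto
qed

section \<open>Holomorphic functions of several variables\<close>

lemma holo_on_subset: "holo_on f V \<Longrightarrow> W \<subseteq> V \<Longrightarrow> holo_on f W"
  unfolding holo_on_def by blast

lemma holo_on_imp_continuous_on: "holo_on f V \<Longrightarrow> continuous_on V f"
  unfolding holo_on_def
  by (meson continuous_at_imp_continuous_on has_derivative_continuous)

lemma holo_on_compose_clinear: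
  assumes f: "holo_on f V" and M: "clinear M"
  shows "holo_on (f \<circ> M) (M -` V)"
  unfolding holo_on_def
proof
  fix z assume "z \<in> M -` V"
  then obtain D where D: "(f has_derivative D) (at (M z))" "\<forall>c x. D (c *s x) = c * D x"
    using f unfolding holo_on_def by blast
  have "(M has_derivative M) (at z)"
    using M clinear_imp_linear linear_conv_bounded_linear bounded_linear_imp_has_derivative by blast
  then have "((f \<circ> M) has_derivative (D \<circ> M)) (at z)"
    using D(1) by (rule diff_chain_at)
  moreover have "\<forall>c x. (D \<circ> M) (c *s x) = c * (D \<circ> M) x"
    using D(2) vec.linear_scale[OF M] by simp
  ultimately show "\<exists>D. ((f \<circ> M) has_derivative D) (at z) \<and> (\<forall>c x. D (c *s x) = c * D x)"
    by blast
qed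

lemma holomorphic_on_line:
  assumes "holo_on f V"
  shows "(\<lambda>t. f (p + t *s q)) holomorphic_on {t. p + t *s q \<in> V}"
  unfolding holomorphic_on_def
proof
  fix t assume "t \<in> {t. p + t *s q \<in> V}"
  then obtain D where D: "(f has_derivative D) (at (p + t *s q))" "\<And>c x. D (c *s x) = c * D x"
    using assms unfolding holo_on_def by auto
  have "((\<lambda>t. p + t *s q) has_derivative (\<lambda>s. s *s q)) (at t)"
    using linear_smult_left[of q]
    by (auto intro!: derivative_eq_intros simp: linear_conv_bounded_linear bounded_linear_imp_has_derivative)
  from diff_chain_at[OF this D(1)]
  have "((\<lambda>t. f (p + t *s q)) has_derivative (\<lambda>s. D (s *s q))) (at t)"
    by (simp add: o_def)
  moreover have "(\<lambda>s. D (s *s q)) = (*) (D q)"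
    using D(2) by (auto simp: mult.commute)
  ultimately show "(\<lambda>t. f (p + t *s q)) field_differentiable at t within {t. p + t *s q \<in> V}"
    by (metis field_differentiable_at_within field_differentiable_def has_field_derivative_def)
qed

lemma holo_on_eq_0_convex:
  assumes g: "holo_on g K" and K: "convex K" "open K"
    and W: "open W" "W \<subseteq> K" "w \<in> W" "\<forall>x\<in>W. g x = 0" and z: "z \<in> K"
  shows "g z = 0"
proof -
  define S where "S = {t. w + t *s (z - w) \<in> K}"
  define T where "T = {t. w + t *s (z - w) \<in> W}"
  have "open S" "open T" "connected S"
    unfolding S_def T_def using K W(1) open_line_vimage convex_line_vimage convex_connected by blast+
  have "T \<noteq> {}" "T \<subseteq> S" "1 \<in> S"
    using W z unfolding S_def T_def by (auto intro!: exI[of _ 0])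
  have "(\<lambda>t. g (w + t *s (z - w))) holomorphic_on S"
    unfolding S_def by (rule holomorphic_on_line[OF g])
  moreover have "\<And>t. t \<in> T \<Longrightarrow> g (w + t *s (z - w)) = 0"
    using W(4) unfolding T_def by blast
  ultimately have "g (w + 1 *s (z - w)) = (\<lambda>_. 0) (1::complex)"
    by (rule analytic_continuation_open[OF \<open>open T\<close> \<open>open S\<close> \<open>T \<noteq> {}\<close> \<open>connected S\<close>
          \<open>T \<subseteq> S\<close> _ holomorphic_on_const _ \<open>1 \<in> S\<close>])
  then show ?thesis by simp
qed

section \<open>Locally closed analytic sets and meagre sets\<close>

definition analytic_chart ::
    "(complex^'a) set \<Rightarrow> (complex^'a) set \<Rightarrow> (complex^'a \<Rightarrow> complex) set \<Rightarrow> bool" where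
  "analytic_chart C V F \<longleftrightarrow>
     open V \<and> convex V \<and> (\<forall>f\<in>F. holo_on f V) \<and> C \<inter> V = {z\<in>V. \<forall>f\<in>F. f z = 0}"

lemma lc_analytic_Int_open:
  assumes C: "lc_analytic C" and "open W"
  shows "lc_analytic (C \<inter> W)"
  unfolding lc_analytic_def
proof (intro conjI ballI)
  show "0 \<notin> C \<inter> W" using C unfolding lc_analytic_def by blast
  fix a assume "a \<in> C \<inter> W"
  then obtain V F where V: "open V" "a \<in> V" "0 \<notin> V" "finite F" "\<forall>f\<in>F. holo_on f V"
      "C \<inter> V = {z\<in>V. \<forall>f\<in>F. f z = 0}"
    using C unfolding lc_analytic_def by blast
  then have "open (V \<inter> W) \<and> a \<in> V \<inter> W \<and> 0 \<notin> V \<inter> W \<and> finite F \<and> (\<forall>f\<in>F. holo_on f (V \<inter> W)) \<and>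
      C \<inter> W \<inter> (V \<inter> W) = {z\<in>V \<inter> W. \<forall>f\<in>F. f z = 0}"
    using \<open>open W\<close> \<open>a \<in> C \<inter> W\<close> holo_on_subset by blast
  then show "\<exists>V F. open V \<and> a \<in> V \<and> 0 \<notin> V \<and> finite F \<and> (\<forall>f\<in>F. holo_on f V) \<and>
      C \<inter> W \<inter> V = {z\<in>V. \<forall>f\<in>F. f z = 0}"
    by blast
qed

lemma lc_analytic_clinear_vimage:
  assumes C: "lc_analytic C" and M: "clinear M"
  shows "lc_analytic (M -` C)"
  unfolding lc_analytic_def
proof (intro conjI ballI)
  show "0 \<notin> M -` C" using C vec.linear_0[OF M] unfolding lc_analytic_def by simp
  fix a assume "a \<in> M -` C"
  then obtain V F where V: "open V" "M a \<in> V" "0 \<notin> V" "finite F" "\<forall>f\<in>F. holo_on f V"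
      "C \<inter> V = {z\<in>V. \<forall>f\<in>F. f z = 0}"
    using C unfolding lc_analytic_def by blast
  have "open (M -` V)" "a \<in> M -` V" "0 \<notin> M -` V"
    using V(1-3) open_clinear_vimage[OF M] vec.linear_0[OF M] by auto
  moreover have "finite ((\<lambda>f. f \<circ> M) ` F)" "\<forall>g\<in>(\<lambda>f. f \<circ> M) ` F. holo_on g (M -` V)"
    using V(4,5) holo_on_compose_clinear[OF _ M] by auto
  moreover have "M -` C \<inter> M -` V = {z\<in>M -` V. \<forall>g\<in>(\<lambda>f. f \<circ> M) ` F. g z = 0}"
    using V(6) by auto
  ultimately show "\<exists>V F. open V \<and> a \<in> V \<and> 0 \<notin> V \<and> finite F \<and> (\<forall>f\<in>F. holo_on f V) \<and>
      M -` C \<inter> V = {z\<in>V. \<forall>f\<in>F. f z = 0}"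
    by blast
qed

lemma lc_analytic_countable_charts:
  fixes C :: "(complex^'a) set"
  assumes "lc_analytic C"
  obtains \<V> F where "countable \<V>" "C \<subseteq> \<Union>\<V>" "\<And>V. V \<in> \<V> \<Longrightarrow> analytic_chart C V (F V)"
proof -
  let ?U = "{V. \<exists>F. analytic_chart C V F}"
  have "\<exists>V\<in>?U. z \<in> V" if "z \<in> C" for z
  proof -
    obtain V F where V: "open V" "z \<in> V" "\<forall>f\<in>F. holo_on f V" "C \<inter> V = {z\<in>V. \<forall>f\<in>F. f z = 0}"
      using assms \<open>z \<in> C\<close> unfolding lc_analytic_def by blast
    obtain r where "r > 0" "ball z r \<subseteq> V"
      using V(1,2) open_contains_ball by blast
    then have "C \<inter> ball z r = {x \<in> ball z r. \<forall>f\<in>F. f x = 0}" "\<forall>f\<in>F. holo_on f (ball z r)"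
      using V(3,4) holo_on_subset by blast+
    then have "analytic_chart C (ball z r) F"
      unfolding analytic_chart_def by simp
    then show ?thesis using \<open>r > 0\<close> by auto
  qed
  moreover obtain \<V> where "\<V> \<subseteq> ?U" "countable \<V>" "\<Union>\<V> = \<Union>?U"
    using Lindelof[of ?U] unfolding analytic_chart_def by blast
  moreover have "analytic_chart C V (SOME F. analytic_chart C V F)" if "V \<in> ?U" for V
    using that by (auto intro: someI)
  ultimately show thesis
    using that[of \<V> "\<lambda>V. SOME F. analytic_chart C V F"] by blast
qed

lemma open_chart_diff:
  assumes "analytic_chart C V F" shows "open (V - C)"
proof -
  have eq: "V - C = (\<Union>f\<in>F. f -` (- {0}) \<inter> V)"
    using assms unfolding analytic_chart_def by blast
  have "open (f -` (- {0}) \<inter> V)" if "f \<in> F" for f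
  proof -
    have "open V" "continuous_on V f"
      using assms that holo_on_imp_continuous_on unfolding analytic_chart_def by auto
    then show ?thesis
      using continuous_on_open_vimage open_Compl[OF closed_singleton] by blast
  qed
  then have "open (\<Union>f\<in>F. f -` (- {0}) \<inter> V)" by blast
  then show ?thesis by (simp only: eq)
qed

lemma open_imp_fsigma:
  fixes S :: "'a::metric_space set"
  assumes "open S" shows "fsigma S"
proof (cases "S = UNIV")
  case True
  then show ?thesis
    using fsigma.intros[of "\<lambda>_. UNIV"] by simp
next
  case False
  have eq: "S = (\<Union>n. {x. 1 / Suc n \<le> infdist x (- S)})"
  proof (intro equalityI subsetI)
    fix x assume "x \<in> S"
    then have "0 < infdist x (- S)"
      using assms False by (intro infdist_pos_not_in_closed) auto
    then obtain n where "1 / Suc n < infdist x (- S)"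
      using nat_approx_posE by blast
    then show "x \<in> (\<Union>n. {x. 1 / Suc n \<le> infdist x (- S)})"
      by (auto intro: less_imp_le)
  next
    fix x assume "x \<in> (\<Union>n. {x. 1 / Suc n \<le> infdist x (- S)})"
    then obtain n where "1 / Suc n \<le> infdist x (- S)" by blast
    moreover have "0 < 1 / real (Suc n)" by simp
    ultimately show "x \<in> S"
      using infdist_zero[of x "- S"] by fastforce
  qed
  have "fsigma (\<Union>n. {x. 1 / Suc n \<le> infdist x (- S)})"
    by (intro fsigma.intros closed_Collect_le continuous_on_const continuous_on_infdist continuous_on_id)
  then show ?thesis
    by (simp only: eq[symmetric])
qed

lemma countable_holomorphic_common_zeros:
  assumes G: "open G" "connected G" and F: "\<forall>f\<in>F. f holomorphic_on G"
    and ne: "{t\<in>G. \<forall>f\<in>F. f t = 0} \<noteq> G"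
  shows "countable {t\<in>G. \<forall>f\<in>F. f t = 0}"
proof -
  obtain f t1 where f: "f \<in> F" "t1 \<in> G" "f t1 \<noteq> 0"
    using ne by blast
  have "countable {t\<in>G. f t = 0}"
  proof (cases "f constant_on G")
    case True
    then have "{t\<in>G. f t = 0} = {}"
      using f unfolding constant_on_def by auto
    then show ?thesis by (metis countable_empty)
  next
    case False
    then show ?thesis
      using holomorphic_countable_zeros F f(1) G open_imp_fsigma by blast
  qed
  then show ?thesis
    by (rule countable_subset[rotated]) (use f(1) in blast)
qed

lemma countable_line_slice_lc_analytic:
  assumes C: "lc_analytic C" and int: "interior {t. p + t *s q \<in> C} = {}"
  shows "countable {t. p + t *s q \<in> C}"
proof -
  obtain \<V> F where "countable \<V>" and cover: "C \<subseteq> \<Union>\<V>"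
    and chart: "\<And>V. V \<in> \<V> \<Longrightarrow> analytic_chart C V (F V)"
    using lc_analytic_countable_charts[OF C] by blast
  define T where "T = {t. p + t *s q \<in> C}"
  define G where "G V = {t. p + t *s q \<in> V}" for V
  have "countable (T \<inter> G V)" if "V \<in> \<V>" for V
  proof (cases "T \<inter> G V = G V")
    case True
    have "open (G V)"
      unfolding G_def using chart[OF that] open_line_vimage unfolding analytic_chart_def by blast
    then have "G V = {}"
      using True interior_maximal[of "G V" T] int unfolding T_def by blast
    then show ?thesis by simp
  next
    case False
    have V: "open V" "convex V" "\<forall>f\<in>F V. holo_on f V" "C \<inter> V = {z\<in>V. \<forall>f\<in>F V. f z = 0}"
      using chart[OF that] unfolding analytic_chart_def by auto
    have G: "open (G V)" "connected (G V)"
      unfolding G_def using V(1,2) open_line_vimage convex_line_vimage convex_connected by blast+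
    have eq: "T \<inter> G V = {t\<in>G V. \<forall>f\<in>(\<lambda>f t. f (p + t *s q)) ` F V. f t = 0}"
      unfolding T_def G_def using V(4) by auto
    have hol: "\<forall>f\<in>(\<lambda>f t. f (p + t *s q)) ` F V. f holomorphic_on G V"
      unfolding G_def using V(3) by (simp add: holomorphic_on_line)
    show ?thesis
      unfolding eq using countable_holomorphic_common_zeros[OF G hol] False unfolding eq .
  qed
  then have "countable (\<Union>V\<in>\<V>. T \<inter> G V)"
    by (rule countable_UN[OF \<open>countable \<V>\<close>])
  moreover have "T \<subseteq> (\<Union>V\<in>\<V>. T \<inter> G V)"
    using cover unfolding T_def G_def by auto
  ultimately show ?thesis
    unfolding T_def[symmetric] by (rule countable_subset[rotated])
qed

lemma chart_identity_clinear_vimage: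
  assumes chart: "analytic_chart C V F" and M: "clinear M" and C: "scaling_invariant C"
    and int: "interior (M -` (C \<inter> cstar_saturation V)) \<noteq> {}"
  shows "M -` V \<subseteq> M -` C"
proof -
  define E where "E = M -` (C \<inter> cstar_saturation V)"
  obtain w0 where "w0 \<in> interior E" using int unfolding E_def by blast
  then obtain s where "s \<noteq> 0" "s *s M w0 \<in> V"
    using interior_subset unfolding E_def cstar_saturation_def by blast
  moreover have "scaling_invariant (interior E)"
    unfolding E_def
    by (intro scaling_invariant_interior scaling_invariant_clinear_vimage scaling_invariant_Int
        M C scaling_invariant_cstar_saturation)
  ultimately have w1: "s *s w0 \<in> interior E \<inter> M -` V"
    using \<open>w0 \<in> interior E\<close> vec.linear_scale[OF M] unfolding scaling_invariant_def by simp
  have V: "open V" "convex V" "\<forall>f\<in>F. holo_on f V" "C \<inter> V = {z\<in>V. \<forall>f\<in>F. f z = 0}"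
    using chart unfolding analytic_chart_def by auto
  have zeros: "f z = 0" if "f \<in> F" "z \<in> C \<inter> V" for f z
    using V(4) that by blast
  have vanish: "(f \<circ> M) z = 0" if "f \<in> F" "z \<in> M -` V" for f z
  proof (rule holo_on_eq_0_convex[of "f \<circ> M" "M -` V" "interior E \<inter> M -` V"])
    show "holo_on (f \<circ> M) (M -` V)"
      using holo_on_compose_clinear[OF _ M] V(3) that(1) by blast
    show "convex (M -` V)"
      using convex_linear_vimage[OF clinear_imp_linear[OF M] V(2)] .
    show "open (M -` V)" "open (interior E \<inter> M -` V)"
      using open_clinear_vimage[OF M V(1)] by auto
    show "\<forall>x\<in>interior E \<inter> M -` V. (f \<circ> M) x = 0"
      using interior_subset[of E] zeros[OF that(1)] unfolding E_def by auto
    show "interior E \<inter> M -` V \<subseteq> M -` V" "s *s w0 \<in> interior E \<inter> M -` V" "z \<in> M -` V"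
      using w1 that(2) by auto
  qed
  show ?thesis
  proof
    fix z assume "z \<in> M -` V"
    then have "M z \<in> {x\<in>V. \<forall>f\<in>F. f x = 0}"
      using vanish by simp
    then show "z \<in> M -` C"
      using V(4) by blast
  qed
qed

lemma proj_lc_analytic_codim1_cline_image:
  assumes "scaling_invariant E" "lc_analytic E" "interior E = {}"
  shows "proj_lc_analytic_codim1 (cline ` E)"
proof -
  have "0 \<notin> E" using assms(2) unfolding lc_analytic_def by blast
  then have "cone (cline ` E) = E" "cline ` E \<subseteq> PS"
    using cone_cline_image[OF assms(1)] by (auto intro!: cline_in_PS)
  then show ?thesis
    using assms(2,3) unfolding proj_lc_analytic_codim1_def by simp
qed

lemma proj_lc_analytic_codim1_empty: "proj_lc_analytic_codim1 {}"
  by (simp add: proj_lc_analytic_codim1_def lc_analytic_def cone_def)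

lemma analytically_meagreI:
  assumes "countable I" "\<And>i. i \<in> I \<Longrightarrow> proj_lc_analytic_codim1 (B i)" "S \<subseteq> (\<Union>i\<in>I. B i)"
  shows "analytically_meagre S"
proof -
  define A where "A n = (if I = {} then {} else B (from_nat_into I n))" for n
  have "proj_lc_analytic_codim1 (A n)" for n
    unfolding A_def
    by (cases "I = {}") (simp_all add: assms(2) from_nat_into proj_lc_analytic_codim1_empty)
  moreover have "S \<subseteq> (\<Union>n. A n)"
  proof
    fix x assume "x \<in> S"
    then obtain i where "i \<in> I" "x \<in> B i" using assms(3) by blast
    moreover obtain n where "from_nat_into I n = i"
      using from_nat_into_surj[OF assms(1) \<open>i \<in> I\<close>] by blast
    ultimately show "x \<in> (\<Union>n. A n)" unfolding A_def by auto
  qed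
  ultimately show ?thesis
    unfolding analytically_meagre_def by blast
qed

lemma analytically_meagre_UN:
  fixes X :: "'i \<Rightarrow> (complex^'n) set set"
  assumes "countable I" "\<And>i. i \<in> I \<Longrightarrow> analytically_meagre (X i)"
  shows "analytically_meagre (\<Union>i\<in>I. X i)"
proof -
  obtain A :: "'i \<Rightarrow> nat \<Rightarrow> (complex^'n) set set"
    where A: "\<And>i n. i \<in> I \<Longrightarrow> proj_lc_analytic_codim1 (A i n)"
      "\<And>i. i \<in> I \<Longrightarrow> X i \<subseteq> (\<Union>n. A i n)"
    using assms(2) unfolding analytically_meagre_def by metis
  show ?thesis
  proof (rule analytically_meagreI[of "I \<times> UNIV" "\<lambda>(i, n). A i n"])
    show "countable (I \<times> (UNIV :: nat set))" using assms(1) by simp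
    show "proj_lc_analytic_codim1 ((\<lambda>(i, n). A i n) p)" if "p \<in> I \<times> UNIV" for p
      using A(1) that by auto
    show "(\<Union>i\<in>I. X i) \<subseteq> (\<Union>p\<in>I \<times> UNIV. (\<lambda>(i, n). A i n) p)"
      using A(2) by fastforce
  qed
qed

lemma analytically_meagre_subset: "analytically_meagre S \<Longrightarrow> T \<subseteq> S \<Longrightarrow> analytically_meagre T"
  unfolding analytically_meagre_def by blast

lemma analytically_meagre_Un:
  assumes "analytically_meagre S" "analytically_meagre T"
  shows "analytically_meagre (S \<union> T)"
proof -
  have "analytically_meagre (\<Union>X\<in>{S, T}. X)"
    by (rule analytically_meagre_UN) (use assms in auto)
  then show ?thesis by simp
qed

lemma proj_lc_analytic_codim1_linear_section:
  assumes "lc_analytic C" "scaling_invariant C" "open V" "clinear M"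
    and "interior (M -` (C \<inter> cstar_saturation V)) = {}"
  shows "proj_lc_analytic_codim1 (cline ` (M -` (C \<inter> cstar_saturation V)))"
  using assms
  by (intro proj_lc_analytic_codim1_cline_image scaling_invariant_clinear_vimage scaling_invariant_Int
      scaling_invariant_cstar_saturation lc_analytic_clinear_vimage lc_analytic_Int_open
      open_cstar_saturation)

lemma line_meets_proj_open_off_null:
  assumes "proj_open U" "u \<in> cone U" "N \<in> null_sets lebesgue"
  obtains t where "cline (u + t *s q) \<in> U" "t \<notin> N"
proof -
  define T where "T = {t. u + t *s q \<in> cone U}"
  have "open T" "0 \<in> T"
    using assms(1,2) open_line_vimage unfolding T_def proj_open_def by auto
  then have "T \<notin> null_sets lebesgue"
    using open_not_negligible negligible_iff_null_sets by blast
  then obtain t where "t \<in> T" "t \<notin> N"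
    using null_sets_completion_subset[OF _ assms(3)] by blast
  then show thesis
    using that unfolding T_def cone_def by blast
qed

section \<open>Linear projection from a point\<close>

locale point_projection =
  fixes v :: "complex^'n" and L :: "complex^'n \<Rightarrow> complex^'m"
  assumes lin_proj_from: "lin_proj_from v L"
begin

lemma clinear_L: "clinear L" and surj_L: "surj L" and L_eq_0_iff: "L u = 0 \<longleftrightarrow> u \<in> cline v"
  using lin_proj_from unfolding lin_proj_from_def by auto

lemma L_line [simp]: "L (u + t *s v) = L u"
proof -
  have "L v = 0" using L_eq_0_iff self_in_cline by blast
  then show ?thesis by (simp add: vec.linear_add[OF clinear_L] vec.linear_scale[OF clinear_L])
qed

lemma line_nonzero: "L u \<noteq> 0 \<Longrightarrow> u + t *s v \<noteq> 0"
  using L_line vec.linear_0[OF clinear_L] by metis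

lemma cline_line_in_fiber:
  assumes "L u \<noteq> 0" shows "cline (u + t *s v) \<in> proj_fiber v L (cline (L u))"
proof -
  have "cline (u + t *s v) \<noteq> cline v"
    using assms L_eq_0_iff self_in_cline L_line by metis
  moreover have "L ` cline (u + t *s v) = cline (L u)"
    by (simp add: clinear_image_cline[OF clinear_L])
  ultimately show ?thesis
    unfolding proj_fiber_def using cline_in_PS[OF line_nonzero[OF assms]] by blast
qed

lemma cline_line_in_cone_iff:
  "L u \<noteq> 0 \<Longrightarrow> cline (u + t *s v) \<in> A \<longleftrightarrow> u + t *s v \<in> cone A"
  unfolding cone_def using line_nonzero by blast

definition lift :: "complex^'m \<Rightarrow> complex^'n" where
  "lift = (SOME R. clinear R \<and> L \<circ> R = id)"

lemma clinear_lift: "clinear lift" and L_lift [simp]: "L (lift w) = w"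
proof -
  have "clinear lift \<and> L \<circ> lift = id"
    unfolding lift_def
    by (rule someI_ex[OF vec.linear_surjective_right_inverse[OF clinear_L surj_L]])
  then show "clinear lift" "L (lift w) = w"
    by (auto simp: fun_eq_iff)
qed

lemma lift_decomposition: "\<exists>\<tau>. z = lift (L z) + \<tau> *s v"
proof -
  have "L (z - lift (L z)) = 0"
    by (simp add: vec.linear_diff[OF clinear_L])
  then obtain \<tau> where "z - lift (L z) = \<tau> *s v"
    using L_eq_0_iff mem_cline_iff by blast
  then show ?thesis
    by (metis add.commute diff_add_cancel)
qed

text \<open>For \<open>w $ i \<noteq> 0\<close> the linear section \<open>tilt c i\<close> of \<open>L\<close> meets the line over \<open>w\<close> at its
  point with parameter \<open>c * w $ i\<close>; a countable dense set of slopes \<open>c\<close> therefore reaches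
  every disc of every such line.\<close>

definition tilt :: "complex \<Rightarrow> 'm \<Rightarrow> complex^'m \<Rightarrow> complex^'n" where
  "tilt c i w = lift w + (c * w $ i) *s v"

lemma tilt_eq_line: "tilt c i w = lift w + c *s (w $ i *s v)"
  by (simp add: tilt_def)

lemma clinear_tilt: "clinear (tilt c i)"
  by (rule clinearI)
    (simp_all add: tilt_def vec.linear_add[OF clinear_lift] vec.linear_scale[OF clinear_lift]
      vec_eq_iff algebra_simps)

lemma open_lift_plus_line_image:
  assumes "open G"
  shows "open ((\<lambda>p. lift (fst p) + snd p *s v) ` G)"
proof -
  have "linear (\<lambda>p. lift (fst p) + snd p *s v)"
    using linear_compose[OF linear_fst clinear_imp_linear[OF clinear_lift]]
      linear_compose[OF linear_snd linear_smult_left]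
    by (intro linear_compose_add) (auto simp: o_def)
  moreover have "z \<in> range (\<lambda>p. lift (fst p) + snd p *s v)" for z
  proof -
    obtain \<tau> where "z = lift (L z) + \<tau> *s v"
      using lift_decomposition by blast
    then show ?thesis
      by (intro range_eqI[of _ _ "(L z, \<tau>)"]) simp
  qed
  ultimately show ?thesis
    using open_surjective_linear_image[OF assms] by blast
qed

lemma open_tilt_region:
  assumes "open D"
  shows "open {tilt c i w | c w. w $ i \<noteq> 0 \<and> c \<in> D}"
proof -
  define G where "G = {p. fst p $ i \<noteq> 0 \<and> snd p / fst p $ i \<in> D}"
  have "open G"
  proof -
    let ?S = "{p :: (complex^'m) \<times> complex. fst p $ i \<noteq> 0}"
    have "open ?S"
      by (intro open_Collect_neq continuous_intros)
    moreover have "continuous_on ?S (\<lambda>p. snd p / fst p $ i)"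
      by (intro continuous_intros) auto
    moreover have "G = ?S \<inter> (\<lambda>p. snd p / fst p $ i) -` D"
      unfolding G_def by auto
    ultimately show ?thesis
      using continuous_open_preimage[OF _ _ assms] by simp
  qed
  moreover have "{tilt c i w | c w. w $ i \<noteq> 0 \<and> c \<in> D} = (\<lambda>p. lift (fst p) + snd p *s v) ` G"
  proof (intro equalityI subsetI)
    fix z assume "z \<in> {tilt c i w | c w. w $ i \<noteq> 0 \<and> c \<in> D}"
    then obtain c w where "z = lift w + (c * w $ i) *s v" "(w, c * w $ i) \<in> G"
      unfolding tilt_def G_def by auto
    then show "z \<in> (\<lambda>p. lift (fst p) + snd p *s v) ` G"
      by (intro image_eqI[of _ _ "(w, c * w $ i)"]) simp_all
  next
    fix z assume "z \<in> (\<lambda>p. lift (fst p) + snd p *s v) ` G"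
    then obtain w \<tau> where "z = tilt (\<tau> / w $ i) i w" "w $ i \<noteq> 0" "\<tau> / w $ i \<in> D"
      unfolding tilt_def G_def by auto
    then show "z \<in> {tilt c i w | c w. w $ i \<noteq> 0 \<and> c \<in> D}" by blast
  qed
  ultimately show ?thesis
    using open_lift_plus_line_image by simp
qed

lemma tilt_region_subset:
  assumes VC: "open (V - C)" and D: "open D" and Q: "\<And>X. open X \<Longrightarrow> X \<noteq> {} \<Longrightarrow> X \<inter> Q \<noteq> {}"
    and sect: "\<And>c. c \<in> D \<inter> Q \<Longrightarrow> tilt c i -` V \<subseteq> tilt c i -` C"
  shows "{tilt c i w | c w. w $ i \<noteq> 0 \<and> c \<in> D} \<inter> V \<subseteq> C"
proof
  fix z assume "z \<in> {tilt c i w | c w. w $ i \<noteq> 0 \<and> c \<in> D} \<inter> V"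
  then obtain c w where z: "z = tilt c i w" "c \<in> D" "z \<in> V" by blast
  show "z \<in> C"
  proof (rule ccontr)
    assume "z \<notin> C"
    define X where "X = D \<inter> {c'. lift w + c' *s (w $ i *s v) \<in> V - C}"
    have "open X"
      unfolding X_def using D open_line_vimage[OF VC] by blast
    moreover have "c \<in> X"
      using z \<open>z \<notin> C\<close> unfolding X_def tilt_eq_line by simp
    ultimately obtain q where "q \<in> X" "q \<in> Q"
      using Q by blast
    then show False
      using sect[of q] unfolding X_def tilt_eq_line by auto
  qed
qed

lemma tilt_sections_with_empty_interior:
  assumes chart: "analytic_chart C V F" and C: "scaling_invariant C" "interior C = {}"
    and Q: "\<And>X. open X \<Longrightarrow> X \<noteq> {} \<Longrightarrow> X \<inter> Q \<noteq> {}"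
    and D: "open D" "c1 \<in> D" and hit: "w $ i \<noteq> 0" "tilt c1 i w \<in> V"
  shows "\<exists>c\<in>D \<inter> Q. interior (tilt c i -` (C \<inter> cstar_saturation V)) = {}"
proof (rule ccontr)
  let ?R = "{tilt c i w | c w. w $ i \<noteq> 0 \<and> c \<in> D} \<inter> V"
  assume "\<not> ?thesis"
  then have "tilt c i -` V \<subseteq> tilt c i -` C" if "c \<in> D \<inter> Q" for c
    using chart_identity_clinear_vimage[OF chart clinear_tilt C(1)] that by blast
  then have "?R \<subseteq> C"
    using tilt_region_subset[OF open_chart_diff[OF chart] D(1) Q] by blast
  moreover have "open ?R"
    using open_tilt_region[OF D(1)] chart unfolding analytic_chart_def by blast
  moreover have "tilt c1 i w \<in> ?R"
    using D(2) hit by blast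
  ultimately show False
    using C(2) interior_maximal by blast
qed

lemma interior_lifted_line_slice:
  assumes C: "lc_analytic C" and nonnull: "{t. u + t *s v \<in> C} \<notin> null_sets lebesgue"
  shows "interior {t. lift (L u) + t *s v \<in> C} \<noteq> {}"
proof -
  have "\<not> countable {t. u + t *s v \<in> C}"
    using nonnull countable_imp_null_set_lborel null_sets_completionI by blast
  then have "interior {t. u + t *s v \<in> C} \<noteq> {}"
    using countable_line_slice_lc_analytic[OF C] by blast
  moreover obtain \<beta> where "u = lift (L u) + \<beta> *s v"
    using lift_decomposition by blast
  then have shift: "lift (L u) + t *s v = u + (t - \<beta>) *s v" for t
    by (simp add: vec_eq_iff algebra_simps)
  have "{t. lift (L u) + t *s v \<in> C} = (+) \<beta> ` {t. u + t *s v \<in> C}"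
  proof (intro equalityI subsetI)
    fix t assume "t \<in> {t. lift (L u) + t *s v \<in> C}"
    then show "t \<in> (+) \<beta> ` {t. u + t *s v \<in> C}"
      unfolding shift by (intro image_eqI[of _ _ "t - \<beta>"]) simp_all
  next
    fix t assume "t \<in> (+) \<beta> ` {t. u + t *s v \<in> C}"
    then show "t \<in> {t. lift (L u) + t *s v \<in> C}"
      unfolding shift by auto
  qed
  ultimately show ?thesis
    by (simp add: interior_translation)
qed

definition bad_lines :: "(complex^'n) set set \<Rightarrow> (complex^'m) set set" where
  "bad_lines S = {cline (L u) | u. L u \<noteq> 0 \<and> {t. cline (u + t *s v) \<in> S} \<notin> null_sets lebesgue}"

lemma nonnull_line_slice_in_tilt_section:
  assumes C: "lc_analytic C" "interior C = {}" "scaling_invariant C"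
    and cover: "C \<subseteq> \<Union>\<V>" and chart: "\<And>V. V \<in> \<V> \<Longrightarrow> analytic_chart C V (F V)"
    and Q: "\<And>X. open X \<Longrightarrow> X \<noteq> {} \<Longrightarrow> X \<inter> Q \<noteq> {}"
    and u: "L u \<noteq> 0" "{t. u + t *s v \<in> C} \<notin> null_sets lebesgue"
  shows "\<exists>V\<in>\<V>. \<exists>i. \<exists>c\<in>Q. interior (tilt c i -` (C \<inter> cstar_saturation V)) = {} \<and>
           L u \<in> tilt c i -` (C \<inter> cstar_saturation V)"
proof -
  obtain t1 where t1: "t1 \<in> interior {t. lift (L u) + t *s v \<in> C}"
    using interior_lifted_line_slice[OF C(1) u(2)] by blast
  then obtain V where V: "V \<in> \<V>" "lift (L u) + t1 *s v \<in> V"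
    using cover interior_subset by blast
  obtain i where i: "L u $ i \<noteq> 0"
    using u(1) by (metis vec_eq_iff zero_index)
  define D where "D = (\<lambda>c. c * L u $ i) -` interior {t. lift (L u) + t *s v \<in> C} \<inter>
      {c. lift (L u) + c *s (L u $ i *s v) \<in> V}"
  have "open V"
    using chart[OF V(1)] unfolding analytic_chart_def by blast
  then have "open D"
    unfolding D_def
    by (intro open_Int continuous_open_vimage open_line_vimage open_interior allI continuous_intros)
  moreover have "t1 / L u $ i \<in> D"
    using t1 V(2) i unfolding D_def by simp
  moreover have "tilt (t1 / L u $ i) i (L u) \<in> V"
    using V(2) i unfolding tilt_def by simp
  ultimately obtain c where c: "c \<in> D" "c \<in> Q"
      "interior (tilt c i -` (C \<inter> cstar_saturation V)) = {}"
    using tilt_sections_with_empty_interior[OF chart[OF V(1)] C(3,2) Q] i by blast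
  have "c * L u $ i \<in> {t. lift (L u) + t *s v \<in> C}"
    using c(1) interior_subset unfolding D_def by blast
  then have "tilt c i (L u) \<in> C"
    unfolding tilt_def by simp
  moreover have "tilt c i (L u) \<in> V"
    using c(1) unfolding D_def tilt_eq_line by simp
  ultimately have "L u \<in> tilt c i -` (C \<inter> cstar_saturation V)"
    using subset_cstar_saturation by blast
  then show ?thesis
    using V(1) c(2,3) by blast
qed

lemma analytically_meagre_bad_lines_codim1:
  assumes A: "proj_lc_analytic_codim1 A"
  shows "analytically_meagre (bad_lines A)"
proof -
  define C where "C = cone A"
  have C: "lc_analytic C" "interior C = {}" "scaling_invariant C"
    using A scaling_invariant_cone unfolding proj_lc_analytic_codim1_def C_def by auto
  obtain \<V> F where "countable \<V>" and cover: "C \<subseteq> \<Union>\<V>"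
    and chart: "\<And>V. V \<in> \<V> \<Longrightarrow> analytic_chart C V (F V)"
    using lc_analytic_countable_charts[OF C(1)] by blast
  obtain Q :: "complex set" where "countable Q" and "\<forall>X. open X \<longrightarrow> X \<noteq> {} \<longrightarrow> (\<exists>q\<in>Q. q \<in> X)"
    using countable_dense_exists by blast
  then have Q: "\<And>X. open X \<Longrightarrow> X \<noteq> {} \<Longrightarrow> X \<inter> Q \<noteq> {}"
    by blast
  define E where "E V i c = tilt c i -` (C \<inter> cstar_saturation V)" for V i c
  define I where "I = {(V, i, c). V \<in> \<V> \<and> c \<in> Q \<and> interior (E V i c) = {}}"
  have "bad_lines A \<subseteq> (\<Union>(V, i, c)\<in>I. cline ` E V i c)"
  proof
    fix x assume "x \<in> bad_lines A"
    then obtain u where x: "x = cline (L u)" "L u \<noteq> 0" and "{t. u + t *s v \<in> C} \<notin> null_sets lebesgue"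
      unfolding bad_lines_def C_def using cline_line_in_cone_iff by auto
    then obtain V i c where "V \<in> \<V>" "c \<in> Q" "interior (E V i c) = {}" "L u \<in> E V i c"
      using nonnull_line_slice_in_tilt_section[OF C cover chart Q] unfolding E_def by blast
    then show "x \<in> (\<Union>(V, i, c)\<in>I. cline ` E V i c)"
      using x(1) unfolding I_def by blast
  qed
  moreover have "countable I"
    using \<open>countable \<V>\<close> \<open>countable Q\<close>
    by (intro countable_subset[of I "\<V> \<times> UNIV \<times> Q"]) (auto simp: I_def countable_finite)
  moreover have "proj_lc_analytic_codim1 (cline ` E V i c)" if "(V, i, c) \<in> I" for V i c
  proof -
    have "open V" "interior (E V i c) = {}"
      using that chart unfolding I_def analytic_chart_def by auto
    then show ?thesis
      unfolding E_def by (rule proj_lc_analytic_codim1_linear_section[OF C(1,3) _ clinear_tilt])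
  qed
  ultimately show ?thesis
    by (intro analytically_meagreI[of I "\<lambda>(V, i, c). cline ` E V i c"]) auto
qed

lemma bad_lines_subset_UN:
  fixes A :: "nat \<Rightarrow> (complex^'n) set set"
  assumes "S \<subseteq> (\<Union>n. A n)"
  shows "bad_lines S \<subseteq> (\<Union>n. bad_lines (A n))"
proof
  fix x assume "x \<in> bad_lines S"
  then obtain u where x: "x = cline (L u)" "L u \<noteq> 0"
    and S: "{t. cline (u + t *s v) \<in> S} \<notin> null_sets lebesgue"
    unfolding bad_lines_def by blast
  have "\<exists>n. {t. cline (u + t *s v) \<in> A n} \<notin> null_sets lebesgue"
  proof (rule ccontr)
    assume "\<not> ?thesis"
    then have "(\<Union>n. {t. cline (u + t *s v) \<in> A n}) \<in> null_sets lebesgue"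
      using null_sets_UN[where N="\<lambda>n. {t. cline (u + t *s v) \<in> A n}" and M=lebesgue] by blast
    moreover have "{t. cline (u + t *s v) \<in> S} \<subseteq> (\<Union>n. {t. cline (u + t *s v) \<in> A n})"
      using assms by blast
    ultimately show False
      using S null_sets_completion_subset by blast
  qed
  then obtain n where "{t. cline (u + t *s v) \<in> A n} \<notin> null_sets lebesgue"
    by blast
  then have "x \<in> bad_lines (A n)"
    unfolding bad_lines_def using x by blast
  then show "x \<in> (\<Union>n. bad_lines (A n))"
    by blast
qed

lemma analytically_meagre_bad_lines:
  assumes "analytically_meagre S" shows "analytically_meagre (bad_lines S)"
proof -
  obtain A :: "nat \<Rightarrow> (complex^'n) set set"
    where A: "\<And>n. proj_lc_analytic_codim1 (A n)" "S \<subseteq> (\<Union>n. A n)"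
    using assms unfolding analytically_meagre_def by metis
  have "analytically_meagre (\<Union>n. bad_lines (A n))"
    by (rule analytically_meagre_UN) (simp_all add: analytically_meagre_bad_lines_codim1 A(1))
  then show ?thesis
    using analytically_meagre_subset bad_lines_subset_UN[OF A(2)] by blast
qed

lemma null_line_slice_off_bad_lines:
  assumes "L u \<noteq> 0" "cline (L u) \<notin> bad_lines S"
  shows "{t. cline (u + t *s v) \<in> S} \<in> null_sets lebesgue"
  using assms unfolding bad_lines_def by blast

lemma fiber_not_covered:
  assumes "L u \<noteq> 0" "{t. cline (u + t *s v) \<in> X} \<in> null_sets lebesgue"
  shows "proj_fiber v L (cline (L u)) - X \<noteq> {}"
proof -
  have "{t. cline (u + t *s v) \<in> X} \<noteq> UNIV"
    using assms(2) non_negligible_UNIV negligible_iff_null_sets by metis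
  then obtain t where "cline (u + t *s v) \<notin> X" by blast
  then show ?thesis
    using cline_line_in_fiber[OF assms(1)] by blast
qed

lemma open_projection:
  assumes "proj_open U" "U \<noteq> {}"
  shows "proj_open (cline ` (L ` cone U - {0}))" "cline ` (L ` cone U - {0}) \<noteq> {}"
proof -
  have "U \<subseteq> PS" "open (cone U)"
    using assms(1) unfolding proj_open_def by auto
  then have "open (L ` cone U)" "cone U \<noteq> {}"
    using open_surjective_linear_image[OF _ clinear_imp_linear[OF clinear_L] surj_L]
      cone_nonempty assms(2) by auto
  then have "L ` cone U \<noteq> {0}"
    using not_open_singleton[of "0 :: complex^'m"] by auto
  then show "cline ` (L ` cone U - {0}) \<noteq> {}"
    using \<open>cone U \<noteq> {}\<close> by auto
  have "scaling_invariant (L ` cone U - {0})"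
    by (intro scaling_invariant_Diff_0 scaling_invariant_clinear_image clinear_L scaling_invariant_cone)
  then have "cone (cline ` (L ` cone U - {0})) = L ` cone U - {0}"
    by (rule cone_cline_image) simp
  moreover have "cline ` (L ` cone U - {0}) \<subseteq> PS"
    using cline_in_PS by blast
  ultimately show "proj_open (cline ` (L ` cone U - {0}))"
    unfolding proj_open_def using \<open>open (L ` cone U)\<close> by (simp add: open_Diff)
qed

lemma proj_dense_meets_projection:
  assumes "proj_dense X" "proj_open U" "U \<noteq> {}"
  obtains u where "u \<in> cone U" "L u \<noteq> 0" "cline (L u) \<in> X"
proof -
  have "cline ` (L ` cone U - {0}) \<inter> X \<noteq> {}"
    using open_projection[OF assms(2,3)] assms(1) unfolding proj_dense_def by simp
  then show thesis
    using that by blast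
qed

end

theorem lemma3p6:
  fixes GN \<Sigma> :: "(complex^'n) set set"
    and GN1 :: "(complex^'m) set set"
    and v :: "complex^'n"
    and L :: "complex^'n \<Rightarrow> complex^'m"
  assumes dim: "CARD('n) = CARD('m) + 1"
    and GN_sub: "GN \<subseteq> PS"
    and Sigma: "analytically_meagre \<Sigma>"
    and GN1_sub: "GN1 \<subseteq> PS"
    and GN1_dense: "\<forall>S. analytically_meagre S \<longrightarrow> proj_dense (GN1 - S)"
    and proj: "lin_proj_from v L"
    and fib: "\<forall>w u. w \<noteq> 0 \<and> L u = w \<and> cline w \<in> GN1 \<and> proj_fiber v L (cline w) - \<Sigma> \<noteq> {}
                 \<longrightarrow> {t::complex. cline (u + t *s v) \<notin> GN} \<in> null_sets lebesgue"
  shows "\<forall>S. analytically_meagre S \<longrightarrow> proj_dense (GN - S)"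
proof (intro allI impI)
  fix S :: "(complex^'n) set set"
  assume S: "analytically_meagre S"
  interpret point_projection v L
    by unfold_locales (rule proj)
  have dense: "proj_dense (GN1 - bad_lines (S \<union> \<Sigma>))"
    using GN1_dense analytically_meagre_bad_lines[OF analytically_meagre_Un[OF S Sigma]] by blast
  show "proj_dense (GN - S)"
    unfolding proj_dense_def
  proof (intro allI impI)
    fix U :: "(complex^'n) set set"
    assume U: "proj_open U \<and> U \<noteq> {}"
    then obtain u where u: "u \<in> cone U" "L u \<noteq> 0" "cline (L u) \<in> GN1 - bad_lines (S \<union> \<Sigma>)"
      using proj_dense_meets_projection[OF dense] by blast
    then have null: "{t. cline (u + t *s v) \<in> S \<union> \<Sigma>} \<in> null_sets lebesgue"
      by (intro null_line_slice_off_bad_lines) auto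
    have "{t. cline (u + t *s v) \<in> \<Sigma>} \<in> null_sets lebesgue"
      by (rule null_sets_completion_subset[OF _ null]) blast
    then have "proj_fiber v L (cline (L u)) - \<Sigma> \<noteq> {}"
      by (rule fiber_not_covered[OF u(2)])
    then have "{t. cline (u + t *s v) \<notin> GN} \<in> null_sets lebesgue"
      using fib[rule_format, of "L u" u] u(2,3) by blast
    then obtain t where "cline (u + t *s v) \<in> U" "cline (u + t *s v) \<in> GN - S"
      using line_meets_proj_open_off_null[OF conjunct1[OF U] u(1) null_sets.Un[OF _ null]] by blast
    then show "U \<inter> (GN - S) \<noteq> {}"
      by blast
  qed
qed

end
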